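(* Let $\alpha\in[0,1)$ and let $n\ge 3$ be an integer. For two communities $C_1,C_2$ of size $n$ each, there is a configuration of $n$ edges between $C_1$ and $C_2$ such that, in the resulting graph (with vertex set $C_1\sqcup C_2$), every intercommunity edge $e$ has positive curvature, $\kappa(e)>0$.
   Context: Graphs are finite, simple, undirected and combinatorial (every edge has length $1$), with vertex set $\mathcal{V}$ and edge set $\mathcal{E}$; $d(\cdot,\cdot)$ is the graph distance and $d_x$ is the degree of a vertex $x$. The graph considered has vertex set the disjoint union $C_1\sqcup C_2$; each community $C_1,C_2$ induces a complete subgraph (any two distinct vertices of the same community are adjacent), and the remaining edges, each with one endpoint in $C_1$ and the other in $C_2$, are the intercommunity edges. A configuration of edges between the communities is a choice of the set of intercommunity edges. For $\alpha\in[0,1]$ and a vertex $x$, the $\alpha$-lazy random walk measure $m_x$ is the probability measure on $\mathcal{V}$ with $m_x(x)=\alpha$, $m_x(z)=\frac{1-\alpha}{d_x}$ if $xz\in\mathcal{E}$, and $m_x(z)=0$ otherwise. The 1-Wasserstein distance between probability measures $\mu,\nu$ on $\mathcal{V}$ is $W(\mu,\nu)=\inf_{\pi}\sum_{u,v}\pi_{uv}\,d(u,v)$, the infimum being over all nonnegative $\pi$ on $\mathcal{V}\times\mathcal{V}$ with marginals $\sum_v\pi_{uv}=\mu(u)$ and $\sum_u\pi_{uv}=\nu(v)$. The ($\alpha$-)Ollivier-Ricci curvature of an edge $e=xy$ is $\kappa(e)=1-W(m_x,m_y)$. *)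

theory Defs
  imports Complex_Main
begin

text \<open>A graph is given by its vertex set \<open>V\<close> and its set \<open>E\<close> of edges, an edge being a
  two-element set of vertices. As loops \<open>{x, x} = {x}\<close> never belong to \<open>E\<close>,
  \<open>{x, z} \<in> E\<close> says that \<open>x\<close> and \<open>z\<close> are distinct adjacent vertices.\<close>

definition vertex_degree :: "'a set set \<Rightarrow> 'a \<Rightarrow> nat" where
  "vertex_degree E x = card {z. {x, z} \<in> E}"

text \<open>The \<open>k\<close>-fold relational power of adjacency relates the endpoints of walks of length \<open>k\<close>.
  The value is only meaningful for \<open>u\<close> and \<open>v\<close> in the same component; this is no restriction
  below, as two cliques joined by at least one edge form a connected graph.\<close>

definition graph_dist :: "'a set set \<Rightarrow> 'a \<Rightarrow> 'a \<Rightarrow> nat" where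
  "graph_dist E u v = (LEAST k. ((\<lambda>a b. {a, b} \<in> E) ^^ k) u v)"

definition lazy_walk :: "real \<Rightarrow> 'a set set \<Rightarrow> 'a \<Rightarrow> 'a \<Rightarrow> real" where
  "lazy_walk \<alpha> E x z =
     (if z = x then \<alpha>
      else if {x, z} \<in> E then (1 - \<alpha>) / real (vertex_degree E x)
      else 0)"

definition transport_plans ::
    "'a set \<Rightarrow> ('a \<Rightarrow> real) \<Rightarrow> ('a \<Rightarrow> real) \<Rightarrow> ('a \<Rightarrow> 'a \<Rightarrow> real) set" where
  "transport_plans V \<mu> \<nu> =
     {\<pi>. (\<forall>u\<in>V. \<forall>v\<in>V. 0 \<le> \<pi> u v) \<and>
         (\<forall>u\<in>V. (\<Sum>v\<in>V. \<pi> u v) = \<mu> u) \<and>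
         (\<forall>v\<in>V. (\<Sum>u\<in>V. \<pi> u v) = \<nu> v)}"

definition wasserstein ::
    "'a set \<Rightarrow> 'a set set \<Rightarrow> ('a \<Rightarrow> real) \<Rightarrow> ('a \<Rightarrow> real) \<Rightarrow> real" where
  "wasserstein V E \<mu> \<nu> =
     (INF \<pi>\<in>transport_plans V \<mu> \<nu>. \<Sum>u\<in>V. \<Sum>v\<in>V. \<pi> u v * real (graph_dist E u v))"

definition ollivier_ricci :: "real \<Rightarrow> 'a set \<Rightarrow> 'a set set \<Rightarrow> 'a \<Rightarrow> 'a \<Rightarrow> real" where
  "ollivier_ricci \<alpha> V E x y = 1 - wasserstein V E (lazy_walk \<alpha> E x) (lazy_walk \<alpha> E y)"

definition complete_edges :: "'a set \<Rightarrow> 'a set set" where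
  "complete_edges C = {{u, v} | u v. u \<in> C \<and> v \<in> C \<and> u \<noteq> v}"

definition cross_pairs :: "'a set \<Rightarrow> 'a set \<Rightarrow> 'a set set" where
  "cross_pairs C1 C2 = {{u, v} | u v. u \<in> C1 \<and> v \<in> C2}"

text \<open>The edge set of the graph on \<open>C1 \<union> C2\<close> with configuration \<open>F \<subseteq> cross_pairs C1 C2\<close>
  of intercommunity edges.\<close>

definition community_edges :: "'a set \<Rightarrow> 'a set \<Rightarrow> 'a set set \<Rightarrow> 'a set set" where
  "community_edges C1 C2 F = complete_edges C1 \<union> complete_edges C2 \<union> F"

end

theory Submission
  imports Defs
begin

text \<open>Join one vertex \<open>x\<^sub>0\<close> of \<open>C\<^sub>1\<close> to all of \<open>C\<^sub>2\<close>. (A perfect matching fails: for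
  \<open>\<alpha> = 0\<close> its curvature is \<open>0\<close>.) For \<open>y \<in> C\<^sub>2\<close> transport between the measures of \<open>x\<^sub>0\<close> and \<open>y\<close> by
  leaving their common part in place and spreading the surplus, of total mass \<open>T\<close>, over the
  deficit proportionally. With \<open>p = (1 - \<alpha>) / (2 * n - 1)\<close> and \<open>q = (1 - \<alpha>) / n\<close>, only mass from
  \<open>C\<^sub>1 - {x\<^sub>0}\<close>, whose surplus is \<open>A = (n - 1) * p\<close>, to \<open>C\<^sub>2\<close>, whose deficit we call \<open>D\<close>, travels
  distance \<open>2\<close>, so the cost is at most \<open>T + A * D / T\<close>. If \<open>\<alpha> \<ge> p\<close>, then already \<open>T + A < 1\<close>;
  if \<open>\<alpha> < p\<close>, then \<open>T + A = 1 - 2 * \<alpha>\<close> and \<open>D < T\<close>, because \<open>x\<^sub>0\<close> has a deficit too.\<close>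

lemma graph_dist_le: "((\<lambda>a b. {a, b} \<in> E) ^^ k) u v \<Longrightarrow> graph_dist E u v \<le> k"
  unfolding graph_dist_def by (rule Least_le)

lemma graph_dist_self [simp]: "graph_dist E u u = 0"
  using graph_dist_le[of 0 E u u] by simp

lemma graph_dist_edge_le: "{u, v} \<in> E \<Longrightarrow> graph_dist E u v \<le> 1"
  by (rule graph_dist_le) (simp add: eq_OO)

lemma graph_dist_two_le: "{u, w} \<in> E \<Longrightarrow> {w, v} \<in> E \<Longrightarrow> graph_dist E u v \<le> 2"
  by (rule graph_dist_le) (auto simp: numeral_2_eq_2 intro!: relcomppI)

lemma graph_dist_commute: "graph_dist E u v = graph_dist E v u"
proof -
  have "((\<lambda>a b. {a, b} \<in> E) ^^ k) v u" if "((\<lambda>a b. {a, b} \<in> E) ^^ k) u v" for k u v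
    using that
  proof (induction k arbitrary: v)
    case (Suc k)
    then obtain w where "((\<lambda>a b. {a, b} \<in> E) ^^ k) u w" "{w, v} \<in> E" by auto
    then show ?case using Suc.IH by (intro relpowp_Suc_I2) (auto simp: insert_commute)
  qed simp
  then have "((\<lambda>a b. {a, b} \<in> E) ^^ k) u v = ((\<lambda>a b. {a, b} \<in> E) ^^ k) v u" for k
    by blast
  then show ?thesis by (simp add: graph_dist_def)
qed

text \<open>The reals are only conditionally complete, so bounding the infimum by one cost requires
  a lower bound on all costs; nonnegativity gives \<open>0\<close>.\<close>

lemma wasserstein_le_cost:
  assumes "\<pi> \<in> transport_plans V \<mu> \<nu>"
  shows "wasserstein V E \<mu> \<nu> \<le> (\<Sum>u\<in>V. \<Sum>v\<in>V. \<pi> u v * real (graph_dist E u v))"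
  unfolding wasserstein_def
  by (rule cINF_lower[OF _ assms], rule bdd_belowI2[where m = 0])
     (auto simp: transport_plans_def intro!: sum_nonneg)

text \<open>Transposing a plan preserves its cost because the distance is symmetric. This handles
  edges \<open>{x, y}\<close> whose hub vertex is listed second.\<close>

lemma wasserstein_commute: "wasserstein V E \<mu> \<nu> = wasserstein V E \<nu> \<mu>"
proof -
  let ?cost = "\<lambda>\<pi>. \<Sum>u\<in>V. \<Sum>v\<in>V. \<pi> u v * real (graph_dist E u v)"
  have cost: "?cost (\<lambda>u v. \<pi> v u) = ?cost \<pi>" for \<pi>
    by (subst sum.swap) (simp add: graph_dist_commute[of E])
  have "?cost ` transport_plans V \<mu> \<nu> \<subseteq> ?cost ` transport_plans V \<nu> \<mu>" for \<mu> \<nu>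
  proof
    fix c assume "c \<in> ?cost ` transport_plans V \<mu> \<nu>"
    then obtain \<pi> where \<pi>: "\<pi> \<in> transport_plans V \<mu> \<nu>" "c = ?cost \<pi>" by blast
    have "c = ?cost (\<lambda>u v. \<pi> v u)" by (rule trans[OF \<pi>(2) cost[symmetric]])
    moreover have "(\<lambda>u v. \<pi> v u) \<in> transport_plans V \<nu> \<mu>"
      using \<pi>(1) by (auto simp: transport_plans_def)
    ultimately show "c \<in> ?cost ` transport_plans V \<nu> \<mu>" by (rule image_eqI)
  qed
  then have "?cost ` transport_plans V \<mu> \<nu> = ?cost ` transport_plans V \<nu> \<mu>" by blast
  then show ?thesis by (simp add: wasserstein_def)
qed

lemma wasserstein_le_proportional:
  fixes \<mu> \<nu> :: "'a \<Rightarrow> real"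
  assumes V: "finite V"
    and \<mu>: "\<And>u. u \<in> V \<Longrightarrow> 0 \<le> \<mu> u" and \<nu>: "\<And>u. u \<in> V \<Longrightarrow> 0 \<le> \<nu> u"
    and P: "(\<Sum>u\<in>V. max 0 (\<mu> u - \<nu> u)) = T" and N: "(\<Sum>u\<in>V. max 0 (\<nu> u - \<mu> u)) = T"
    and T: "0 < T"
  shows "wasserstein V E \<mu> \<nu> \<le>
    (\<Sum>u\<in>V. \<Sum>v\<in>V. max 0 (\<mu> u - \<nu> u) * max 0 (\<nu> v - \<mu> v) * real (graph_dist E u v)) / T"
proof -
  \<comment> \<open>The diagonal term keeps the common mass in place at no cost; the product term is
    the independent coupling of surplus and deficit, scaled by \<open>1 / T\<close> to have total
    mass \<open>T\<close>.\<close>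
  define \<pi> where "\<pi> u v = (if u = v then min (\<mu> u) (\<nu> u) else 0) +
    max 0 (\<mu> u - \<nu> u) * max 0 (\<nu> v - \<mu> v) / T" for u v
  have "(\<Sum>v\<in>V. \<pi> u v) = \<mu> u" if "u \<in> V" for u
  proof -
    have "(\<Sum>v\<in>V. \<pi> u v) = min (\<mu> u) (\<nu> u) + max 0 (\<mu> u - \<nu> u) * T / T"
      using V that unfolding \<pi>_def
      by (simp add: sum.distrib N flip: sum_divide_distrib sum_distrib_left)
    then show ?thesis using T by simp
  qed
  moreover have "(\<Sum>u\<in>V. \<pi> u v) = \<nu> v" if "v \<in> V" for v
  proof -
    have "(\<Sum>u\<in>V. \<pi> u v) = min (\<mu> v) (\<nu> v) + T * max 0 (\<nu> v - \<mu> v) / T"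
      using V that unfolding \<pi>_def
      by (simp add: sum.distrib P flip: sum_divide_distrib sum_distrib_right)
    then show ?thesis using T by simp
  qed
  moreover have "0 \<le> \<pi> u v" if "u \<in> V" "v \<in> V" for u v
    using that \<mu> \<nu> T by (auto simp: \<pi>_def)
  ultimately have "\<pi> \<in> transport_plans V \<mu> \<nu>" by (simp add: transport_plans_def)
  then have "wasserstein V E \<mu> \<nu> \<le> (\<Sum>u\<in>V. \<Sum>v\<in>V. \<pi> u v * real (graph_dist E u v))"
    by (rule wasserstein_le_cost)
  also have "\<dots> = (\<Sum>u\<in>V. \<Sum>v\<in>V.
      max 0 (\<mu> u - \<nu> u) * max 0 (\<nu> v - \<mu> v) * real (graph_dist E u v) / T)"
    by (intro sum.cong) (auto simp: \<pi>_def)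
  finally show ?thesis by (simp add: sum_divide_distrib)
qed

lemma doubleton_in_complete_edges: "{u, v} \<in> complete_edges C \<longleftrightarrow> u \<in> C \<and> v \<in> C \<and> u \<noteq> v"
  by (auto simp: complete_edges_def doubleton_eq_iff)

lemma wasserstein_star_less_one:
  fixes \<alpha> :: real and C1 C2 :: "'a set"
  defines "E \<equiv> \<lambda>x. community_edges C1 C2 ((\<lambda>y. {x, y}) ` C2)"
  assumes \<alpha>: "0 \<le> \<alpha>" "\<alpha> < 1" and n: "2 \<le> n"
    and fin: "finite C1" "finite C2" and disj: "C1 \<inter> C2 = {}"
    and card: "card C1 = n" "card C2 = n"
    and x: "x \<in> C1" and y: "y \<in> C2"
  shows "wasserstein (C1 \<union> C2) (E x) (lazy_walk \<alpha> (E x) x) (lazy_walk \<alpha> (E x) y) < 1"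
proof -
  define V A B where "V = C1 \<union> C2" and "A = C1 - {x}" and "B = C2 - {y}"
  define \<mu> \<nu> where "\<mu> = lazy_walk \<alpha> (E x) x" and "\<nu> = lazy_walk \<alpha> (E x) y"
  define p q where "p = (1 - \<alpha>) / (2 * real n - 1)" and "q = (1 - \<alpha>) / real n"
  have AB: "x \<noteq> y" "x \<notin> A" "x \<notin> B" "y \<notin> A" "y \<notin> B" "A \<inter> B = {}" "finite A" "finite B"
    and C1: "C1 = insert x A" and C2: "C2 = insert y B"
    using x y disj fin by (auto simp: A_def B_def)
  have cards: "real (card A) = real n - 1" "real (card B) = real n - 1"
    using x y fin card n by (auto simp: A_def B_def of_nat_diff)
  have edge: "{u, v} \<in> E x \<longleftrightarrow> u \<noteq> v \<and> (u \<in> C1 \<and> v \<in> C1 \<or> u \<in> C2 \<and> v \<in> C2 \<or>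
      u = x \<and> v \<in> C2 \<or> v = x \<and> u \<in> C2)" for u v
    using x disj
    by (auto simp: E_def community_edges_def doubleton_in_complete_edges doubleton_eq_iff)
  have "{z. {x, z} \<in> E x} = A \<union> insert y B"
    using x disj AB by (auto simp: edge C1 C2)
  then have degx: "real (vertex_degree (E x) x) = 2 * real n - 1"
    using AB cards by (simp add: vertex_degree_def card_Un_disjoint)
  have "{z. {y, z} \<in> E x} = insert x B"
    using x disj AB by (auto simp: edge C1 C2)
  then have degy: "real (vertex_degree (E x) y) = real n"
    using AB cards by (simp add: vertex_degree_def)
  have \<mu>: "\<mu> x = \<alpha>" "\<mu> y = p" "\<And>z. z \<in> A \<Longrightarrow> \<mu> z = p" "\<And>z. z \<in> B \<Longrightarrow> \<mu> z = p"
    using AB by (auto simp: \<mu>_def lazy_walk_def degx p_def edge C1 C2)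
  have \<nu>: "\<nu> x = q" "\<nu> y = \<alpha>" "\<And>z. z \<in> A \<Longrightarrow> \<nu> z = 0" "\<And>z. z \<in> B \<Longrightarrow> \<nu> z = q"
    using AB by (auto simp: \<nu>_def lazy_walk_def degy q_def edge C1 C2)
  have pq: "p < q"
    unfolding p_def q_def using \<alpha> n by (intro divide_strict_left_mono) auto
  have p: "0 < p" and q: "0 < q"
    and np: "2 * (real n * p) = 1 - \<alpha> + p" and nq: "real n * q = 1 - \<alpha>"
    using \<alpha> n by (auto simp: p_def q_def field_simps)
  define P N where "P = (\<lambda>u. max 0 (\<mu> u - \<nu> u))" and "N = (\<lambda>u. max 0 (\<nu> u - \<mu> u))"
  \<comment> \<open>Surplus sits on \<open>A\<close>, at \<open>x\<close> if \<alpha> exceeds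
    \<open>q\<close>, and at \<open>y\<close> if \<open>p\<close> exceeds \<alpha>; on
    \<open>B\<close> there is none since \<open>p < q\<close>. Likewise \<open>D\<close> collects
    the deficits of \<open>B\<close> and \<open>y\<close>.\<close>
  define T where "T = (real n - 1) * p + max 0 (\<alpha> - q) + max 0 (p - \<alpha>)"
  define D where "D = (real n - 1) * (q - p) + max 0 (\<alpha> - p)"
  have V: "V = insert x A \<union> insert y B" by (simp add: V_def C1 C2)
  have sumV: "(\<Sum>u\<in>V. f u) = f x + sum f A + f y + sum f B" for f :: "'a \<Rightarrow> real"
    unfolding V using AB by (subst sum.union_disjoint) auto
  have PA: "sum P A = (real n - 1) * p"
    using p by (simp add: P_def \<mu> \<nu> cards)
  have sumP: "sum P V = T"
    using pq by (simp add: sumV PA) (simp add: P_def \<mu> \<nu> T_def)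
  have NC2: "sum N C2 = D"
    using AB pq by (simp add: C2 N_def \<mu> \<nu> cards D_def)
  have sumN_D: "sum N V = max 0 (q - \<alpha>) + D"
    using AB p NC2 by (simp add: sumV C2) (simp add: N_def \<mu> \<nu>)
  \<comment> \<open>Both measures have total mass 1, so surplus and deficit agree; the computation
    rests on \<open>max 0 t = t + max 0 (- t)\<close>.\<close>
  have "max 0 (q - \<alpha>) + D = T"
  proof -
    have "max 0 (q - \<alpha>) = q - \<alpha> + max 0 (\<alpha> - q)"
      and "max 0 (\<alpha> - p) = \<alpha> - p + max 0 (p - \<alpha>)" by auto
    then show ?thesis using np nq by (simp add: D_def T_def algebra_simps)
  qed
  with sumN_D have sumN: "sum N V = T" and DT: "D \<le> T" by auto
  have Apos: "0 < (real n - 1) * p" using p n by simp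
  then have T: "0 < T" by (simp add: T_def add_pos_nonneg)
  have "wasserstein V (E x) \<mu> \<nu> \<le> (\<Sum>u\<in>V. \<Sum>v\<in>V. P u * N v * real (graph_dist (E x) u v)) / T"
    unfolding P_def N_def
  proof (rule wasserstein_le_proportional)
    show "finite V" using fin by (simp add: V_def)
    show "0 \<le> \<mu> u" "0 \<le> \<nu> u" if "u \<in> V" for u
      using that \<alpha> p q by (auto simp: V \<mu> \<nu>)
  qed (use sumP sumN T in \<open>auto simp: P_def N_def\<close>)
  \<comment> \<open>Distance 2 is charged as a second copy of \<open>P u * N v\<close>, on
    \<open>A\<close> times \<open>C2\<close> only, so that the double sum factors.\<close>
  also have "\<dots> \<le> (\<Sum>u\<in>V. \<Sum>v\<in>V. P u * N v +
      (if u \<in> A then P u else 0) * (if v \<in> C2 then N v else 0)) / T"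
  proof (intro divide_right_mono sum_mono)
    fix u v assume uv: "u \<in> V" "v \<in> V"
    have PN: "0 \<le> P u * N v" by (simp add: P_def N_def)
    \<comment> \<open>Vertices of \<open>A\<close> have no deficit, so pairs from \<open>C2\<close>
      to \<open>A\<close> carry no mass, whatever their distance. In the last case \<open>v\<close>
      is the hub, or \<open>v\<close> lies in \<open>C2\<close> and \<open>u\<close> is the hub or
      in \<open>C2\<close>.\<close>
    consider "v \<in> A" | "u \<in> A" "v \<in> C2" | "v \<notin> A" "\<not> (u \<in> A \<and> v \<in> C2)" by blast
    then show "P u * N v * real (graph_dist (E x) u v) \<le>
      P u * N v + (if u \<in> A then P u else 0) * (if v \<in> C2 then N v else 0)"
    proof cases
      case 1
      then have "N v = 0" using p by (simp add: N_def \<mu> \<nu>)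
      then show ?thesis by simp
    next
      case 2
      then have "graph_dist (E x) u v \<le> 2"
        using AB x disj by (intro graph_dist_two_le[of _ x]) (auto simp: edge C1)
      then have "P u * N v * real (graph_dist (E x) u v) \<le> P u * N v * 2"
        using PN by (intro mult_left_mono) auto
      then show ?thesis using 2 by (simp add: mult.commute)
    next
      case 3
      have "graph_dist (E x) u v \<le> 1"
      proof (cases "u = v")
        case False
        with 3 uv show ?thesis
          by (intro graph_dist_edge_le) (auto simp: edge V C1 C2)
      qed simp
      then have "P u * N v * real (graph_dist (E x) u v) \<le> P u * N v * 1"
        using PN by (intro mult_left_mono) auto
      then show ?thesis using 3 by auto
    qed
  qed (use T in simp)
  also have "\<dots> = (sum P V * sum N V + sum P A * sum N C2) / T"
  proof -
    have "sum P A = (\<Sum>u\<in>V. if u \<in> A then P u else 0)"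
      and "sum N C2 = (\<Sum>v\<in>V. if v \<in> C2 then N v else 0)"
      using fin by (auto simp: V_def A_def sum.If_cases intro!: sum.cong)
    then show ?thesis by (simp add: sum_product sum.distrib)
  qed
  also have "\<dots> = T + (real n - 1) * p * (D / T)"
    using T by (simp add: sumP sumN PA NC2 field_simps)
  also have "\<dots> < 1"
  proof (cases "p \<le> \<alpha>")
    case True
    have "(real n - 1) * p * (D / T) \<le> (real n - 1) * p * 1"
      using DT T Apos by (intro mult_left_mono) auto
    \<comment> \<open>By \<open>np\<close> the left side is
      \<open>1 - \<alpha> - p + max 0 (\<alpha> - q)\<close>, that is,
      \<open>1 - \<alpha> - p\<close> or \<open>1 - p - q\<close>.\<close>
    moreover have "T + (real n - 1) * p < 1"
      using True np p q \<alpha> by (simp add: T_def algebra_simps max_def)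
    ultimately show ?thesis by simp
  next
    case False
    \<comment> \<open>For \<alpha> = 0 the bound \<open>T + (real n - 1) * p\<close> equals 1, so
      strictness has to come from the deficit \<open>q - \<alpha> > 0\<close> at
      \<open>x\<close>.\<close>
    have "D < T" using \<open>max 0 (q - \<alpha>) + D = T\<close> False pq by simp
    then have "(real n - 1) * p * (D / T) < (real n - 1) * p * 1"
      using T Apos by (intro mult_strict_left_mono) auto
    moreover have "T + (real n - 1) * p \<le> 1"
      using False np pq \<alpha> by (simp add: T_def algebra_simps max_def)
    ultimately show ?thesis by simp
  qed
  finally show ?thesis by (simp add: V_def \<mu>_def \<nu>_def)
qed

theorem proposition5p1:
  fixes \<alpha> :: real and n :: nat and C1 C2 :: "'a set"
  assumes "0 \<le> \<alpha>" and "\<alpha> < 1" and "3 \<le> n"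
    and "finite C1" and "finite C2" and "C1 \<inter> C2 = {}"
    and "card C1 = n" and "card C2 = n"
  shows "\<exists>F. F \<subseteq> cross_pairs C1 C2 \<and> card F = n \<and>
           (\<forall>x y. {x, y} \<in> F \<longrightarrow>
              0 < ollivier_ricci \<alpha> (C1 \<union> C2) (community_edges C1 C2 F) x y)"
proof -
  obtain x0 where x0: "x0 \<in> C1" using assms by fastforce
  let ?F = "(\<lambda>y. {x0, y}) ` C2"
  have "?F \<subseteq> cross_pairs C1 C2" using x0 by (auto simp: cross_pairs_def)
  moreover have "card ?F = n"
    using assms by (subst card_image) (auto simp: inj_on_def doubleton_eq_iff)
  moreover have "0 < ollivier_ricci \<alpha> (C1 \<union> C2) (community_edges C1 C2 ?F) x y"
    if "{x, y} \<in> ?F" for x y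
  proof -
    have "x = x0 \<and> y \<in> C2 \<or> y = x0 \<and> x \<in> C2"
      using that by (auto simp: doubleton_eq_iff)
    then show ?thesis
      using wasserstein_star_less_one[of \<alpha> n C1 C2 x0] assms x0
      by (auto simp: ollivier_ricci_def wasserstein_commute[of _ _ _ "lazy_walk _ _ x0"])
  qed
  ultimately show ?thesis by blast
qed

end
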